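(* Let $f$ be a twist map of the annulus, let $c\in\mathbb{R}$, and let $T^-$ and $T^+$ be the discrete backward and forward Lax-Oleinik operators associated with $S_c$. Then for any bounded function $u:\mathbb{T}\to\mathbb{R}$, the function $T^{+}\circ T^{-2}[u]$ is $C^{1,1}$.
   Context: Let $\mathbb{T}=\mathbb{R}/\mathbb{Z}$. A twist map of the annulus is a $C^1$-diffeomorphism $f:\mathbb{T}\times\mathbb{R}\to\mathbb{T}\times\mathbb{R}$ such that: (1) $f$ is isotopic to the identity; (2) $f$ is exact symplectic, i.e. if $f(\theta,p)=(\theta',p')$ then the $1$-form $p'd\theta'-p\,d\theta$ is exact; (3) if $F:\mathbb{R}^2\to\mathbb{R}^2$, $F(x,p)=(y,p')$, is a lift of $f$, there is $\varepsilon>0$ with $0<\frac{\partial y}{\partial p}(x,p)<\frac1\varepsilon$ for all $(x,p)$. Fix a lift $F$ of $f$. Its generating function is a $C^2$ function $S:\mathbb{R}^2\to\mathbb{R}$ (which exists and is unique up to an additive constant) such that $S(x+1,y+1)=S(x,y)$; there is $\varepsilon>0$ with $\frac{\partial^2S}{\partial x\partial y}<-\varepsilon$ everywhere; and $F(x,p)=(y,p')$ if and only if $p=-\partial_1S(x,y)$ and $p'=\partial_2S(x,y)$. For $c\in\mathbb{R}$ put $S_c(x,y)=S(x,y)+c(x-y)$. Functions on $\mathbb{T}$ are identified with $1$-periodic functions on $\mathbb{R}$. For a bounded $1$-periodic function $u:\mathbb{R}\to\mathbb{R}$ (not necessarily continuous), $$T^-[u](x)=\inf_{y\in\mathbb{R}}\{u(y)+S_c(y,x)\},\qquad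 T^+[u](x)=\sup_{y\in\mathbb{R}}\{u(y)-S_c(x,y)\},$$ and $T^{-2}=T^-\circ T^-$. A function is $C^{1,1}$ if it is differentiable with uniformly Lipschitz derivative. *)

theory Defs
  imports "HOL-Analysis.Analysis"
begin

quotient_type circle = real / "\<lambda>x y. x - y \<in> \<int>"
proof (rule equivpI)
  show "reflp (\<lambda>x y :: real. x - y \<in> \<int>)"
    by (simp add: reflp_def)
  show "symp (\<lambda>x y :: real. x - y \<in> \<int>)"
  proof (rule sympI)
    fix x y :: real
    assume "x - y \<in> \<int>"
    then have "- (x - y) \<in> \<int>" by (rule Ints_minus)
    then show "y - x \<in> \<int>" by simp
  qed
  show "transp (\<lambda>x y :: real. x - y \<in> \<int>)"
  proof (rule transpI)
    fix x y z :: real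
    assume "x - y \<in> \<int>" "y - z \<in> \<int>"
    then have "(x - y) + (y - z) \<in> \<int>" by (rule Ints_add)
    then show "x - z \<in> \<int>" by simp
  qed
qed

text \<open>The quotient topology of \<open>\<real>/\<int>\<close>; the annulus \<^typ>\<open>circle \<times> real\<close> then carries the product topology.\<close>

instantiation circle :: topological_space
begin

definition open_circle :: "circle set \<Rightarrow> bool"
  where "open_circle U \<longleftrightarrow> open (abs_circle -` U)"

instance
  by standard (simp_all add: open_circle_def vimage_Union open_Int open_UN)

end

type_synonym annulus = "circle \<times> real"

definition annulus_proj :: "real \<times> real \<Rightarrow> annulus"
  where "annulus_proj z = (abs_circle (fst z), snd z)"

definition C1_on :: "'a::real_normed_vector set \<Rightarrow> ('a \<Rightarrow> 'b::real_normed_vector) \<Rightarrow> bool"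
  where "C1_on U g \<longleftrightarrow>
    (\<exists>g' :: 'a \<Rightarrow> 'a \<Rightarrow>\<^sub>L 'b.
      (\<forall>z\<in>U. (g has_derivative blinfun_apply (g' z)) (at z)) \<and> continuous_on U g')"

definition C2_on :: "'a::real_normed_vector set \<Rightarrow> ('a \<Rightarrow> 'b::real_normed_vector) \<Rightarrow> bool"
  where "C2_on U g \<longleftrightarrow>
    (\<exists>g' :: 'a \<Rightarrow> 'a \<Rightarrow>\<^sub>L 'b.
      (\<forall>z\<in>U. (g has_derivative blinfun_apply (g' z)) (at z)) \<and> C1_on U g')"

definition C11 :: "(real \<Rightarrow> real) \<Rightarrow> bool"
  where "C11 g \<longleftrightarrow> (\<forall>x. g differentiable (at x)) \<and> (\<exists>L. L-lipschitz_on UNIV (deriv g))"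

definition lifts_on :: "(real \<times> real) set \<Rightarrow> (real \<times> real \<Rightarrow> real \<times> real) \<Rightarrow> (annulus \<Rightarrow> annulus) \<Rightarrow> bool"
  where "lifts_on U F f \<longleftrightarrow>
    open U \<and> continuous_on U F \<and> (\<forall>z\<in>U. annulus_proj (F z) = f (annulus_proj z))"

abbreviation is_lift :: "(real \<times> real \<Rightarrow> real \<times> real) \<Rightarrow> (annulus \<Rightarrow> annulus) \<Rightarrow> bool"
  where "is_lift F f \<equiv> lifts_on UNIV F f"

text \<open>The charts of the annulus are the local inverses of \<^const>\<open>annulus_proj\<close>, so the coordinate
  expressions of a map are its local lifts.\<close>

definition annulus_C1 :: "(annulus \<Rightarrow> annulus) \<Rightarrow> bool"
  where "annulus_C1 f \<longleftrightarrow> (\<forall>z. \<exists>U F. z \<in> U \<and> lifts_on U F f \<and> C1_on U F)"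

definition annulus_C1_diffeo :: "(annulus \<Rightarrow> annulus) \<Rightarrow> bool"
  where "annulus_C1_diffeo f \<longleftrightarrow> bij f \<and> annulus_C1 f \<and> annulus_C1 (inv f)"

definition isotopic_to_id :: "(annulus \<Rightarrow> annulus) \<Rightarrow> bool"
  where "isotopic_to_id f \<longleftrightarrow>
    homotopic_with (homeomorphic_map euclidean euclidean) euclidean euclidean id f"

text \<open>The primitive \<open>V\<close> of \<open>p' d\<theta>' - p d\<theta>\<close> must be a function on the annulus. In local
  coordinates \<open>F(\<theta>, p) = (\<theta>', p')\<close> the value of \<open>p' d\<theta>' - p d\<theta>\<close> at \<open>z\<close> on a tangent vector \<open>h\<close> is
  \<open>snd (F z) * fst (DF(z) h) - snd z * fst h\<close>.\<close>

definition exact_symplectic :: "(annulus \<Rightarrow> annulus) \<Rightarrow> bool"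
  where "exact_symplectic f \<longleftrightarrow>
    (\<exists>V :: annulus \<Rightarrow> real. \<forall>U F. lifts_on U F f \<longrightarrow>
      (\<forall>z\<in>U. ((\<lambda>w. V (annulus_proj w)) has_derivative
        (\<lambda>h. snd (F z) * fst (frechet_derivative F (at z) h) - snd z * fst h)) (at z)))"

definition twist_map :: "(annulus \<Rightarrow> annulus) \<Rightarrow> bool"
  where "twist_map f \<longleftrightarrow>
    annulus_C1_diffeo f \<and> isotopic_to_id f \<and> exact_symplectic f \<and>
    (\<forall>F. is_lift F f \<longrightarrow>
      (\<exists>\<epsilon>>0. \<forall>x p. 0 < deriv (\<lambda>q. fst (F (x, q))) p \<and> deriv (\<lambda>q. fst (F (x, q))) p < 1 / \<epsilon>))"

definition partial1 :: "(real \<times> real \<Rightarrow> real) \<Rightarrow> real \<times> real \<Rightarrow> real"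
  where "partial1 S = (\<lambda>(x, y). deriv (\<lambda>s. S (s, y)) x)"

definition partial2 :: "(real \<times> real \<Rightarrow> real) \<Rightarrow> real \<times> real \<Rightarrow> real"
  where "partial2 S = (\<lambda>(x, y). deriv (\<lambda>t. S (x, t)) y)"

definition generating_function ::
    "(real \<times> real \<Rightarrow> real) \<Rightarrow> (real \<times> real \<Rightarrow> real \<times> real) \<Rightarrow> bool"
  where "generating_function S F \<longleftrightarrow>
    C2_on UNIV S \<and>
    (\<forall>x y. S (x + 1, y + 1) = S (x, y)) \<and>
    (\<exists>\<epsilon>>0. \<forall>x y. partial1 (partial2 S) (x, y) < - \<epsilon>) \<and>
    (\<forall>x p y p'. F (x, p) = (y, p') \<longleftrightarrow> p = - partial1 S (x, y) \<and> p' = partial2 S (x, y))"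

definition S_c :: "(real \<times> real \<Rightarrow> real) \<Rightarrow> real \<Rightarrow> real \<times> real \<Rightarrow> real"
  where "S_c S c = (\<lambda>(x, y). S (x, y) + c * (x - y))"

text \<open>For a generating function \<open>S\<close> and a bounded \<open>u\<close>, the infimum and the supremum below are finite
  (\<^term>\<open>S_c S c (x, y)\<close> is bounded below because of the bound on its mixed derivative), so they can be
  taken in the reals.\<close>

definition T_minus :: "(real \<times> real \<Rightarrow> real) \<Rightarrow> real \<Rightarrow> (real \<Rightarrow> real) \<Rightarrow> real \<Rightarrow> real"
  where "T_minus S c u x = (INF y. u y + S_c S c (y, x))"

definition T_plus :: "(real \<times> real \<Rightarrow> real) \<Rightarrow> real \<Rightarrow> (real \<Rightarrow> real) \<Rightarrow> real \<Rightarrow> real"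
  where "T_plus S c u x = (SUP y. u y - S_c S c (x, y))"

end

theory Submission
  imports Defs
begin

text \<open>
  Put \<open>A = S_c\<close>, \<open>v = T\<^sup>- u\<close>, \<open>w = T\<^sup>- v\<close> and \<open>\<psi> = T\<^sup>+ w\<close>. As the infimum of the functions
  \<open>u y + A (y, _)\<close>, of which only those with \<open>y\<close> at bounded distance from the argument matter, \<open>v\<close> is
  semiconcave. The remaining operators \<open>T\<^sup>+ \<circ> T\<^sup>-\<close> turn a continuous semiconcave function into a
  C11 one, because at each point \<open>\<psi>\<close> is squeezed between two parabolas with a common tangent and a
  uniform curvature.

  The lower parabola comes from \<open>\<psi>\<close> being a supremum: for each \<open>z\<close> the \<^emph>\<open>barrier\<close>
  \<open>\<phi> x = w z - A (x, z)\<close> satisfies \<open>\<phi> \<le> \<psi>\<close>, and its second derivative is bounded near \<open>z\<close>.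

  For the upper one, call \<open>y\<close> a minimizer for \<open>z\<close> if it attains the infimum defining \<open>w z\<close>. Every
  \<open>x\<close> lies between two minimizers \<open>a \<le> x \<le> b\<close> for one common \<open>z\<close> (lemma \<open>bracketing_minimizers\<close>, a
  connectedness argument), and the twist condition gives \<open>\<psi> = \<phi>\<close> on all of \<open>[a, b]\<close> (lemma
  \<open>forward_backward_between_minimizers\<close>). So only the behaviour outside \<open>[a, b]\<close> is in question,
  and there \<open>\<psi> \<le> v\<close>. Since \<open>v - \<phi>\<close> is nonnegative, vanishes at \<open>a\<close> and \<open>b\<close>, and is semiconcave near
  them, it is at most quadratic in the distance to \<open>a\<close> or \<open>b\<close>, which for a point outside
  \<open>[a, b]\<close> is smaller than the distance to \<open>x\<close>. Hence \<open>\<psi>\<close> exceeds \<open>\<phi>\<close> by a term quadratic in the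
  distance to \<open>x\<close>.

  Everything happens at bounded distance from the diagonal because \<open>A\<close> is coercive: along
  \<open>y, y + 1, y + 2, \<dots>\<close> the twist condition and diagonal periodicity make the second differences of
  \<open>A (x, _)\<close> at least \<open>\<epsilon>\<close>.
\<close>

section \<open>A criterion for being C11\<close>

lemma small_scale_lipschitz_imp_lipschitz:
  fixes p :: "real \<Rightarrow> real"
  assumes small: "\<And>x h. \<bar>h\<bar> \<le> 1 \<Longrightarrow> \<bar>p (x + h) - p x\<bar> \<le> K * \<bar>h\<bar>"
  shows "K-lipschitz_on UNIV p"
proof (rule lipschitz_onI)
  show "0 \<le> K" using small[of 1 0] by simp
  have steps: "\<bar>p (x + real n * h) - p x\<bar> \<le> real n * (K * \<bar>h\<bar>)" if "\<bar>h\<bar> \<le> 1" for x h n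
  proof (induction n)
    case (Suc n)
    have "\<bar>p (x + real n * h + h) - p (x + real n * h)\<bar> \<le> K * \<bar>h\<bar>" using small[OF that] .
    moreover have "x + real (Suc n) * h = x + real n * h + h" by (simp add: algebra_simps)
    ultimately show ?case using Suc by (simp add: algebra_simps)
  qed simp
  fix x y :: real
  obtain m :: nat where m: "\<bar>x - y\<bar> \<le> real m" using real_arch_simple by blast
  define n where "n = Suc m"
  define h where "h = (x - y) / real n"
  have nh: "real n * h = x - y" by (simp add: h_def n_def)
  have "\<bar>h\<bar> \<le> 1" using m by (simp add: h_def n_def abs_divide divide_simps)
  from steps[OF this, of y n] have "\<bar>p x - p y\<bar> \<le> real n * (K * \<bar>h\<bar>)"
    by (simp add: nh)
  also have "\<dots> = K * \<bar>real n * h\<bar>" by (simp add: abs_mult)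
  finally have "\<bar>p x - p y\<bar> \<le> K * \<bar>real n * h\<bar>" .
  then show "dist (p x) (p y) \<le> K * dist x y" by (simp add: nh dist_real_def)
qed

text \<open>A first-order expansion whose quadratic error has a uniform constant determines the derivative, and
  two such expansions at neighbouring points force their slopes to be close.\<close>

lemma C11_if_quadratic_expansion:
  assumes expansion: "\<And>x. \<exists>p. \<forall>h. \<bar>h\<bar> \<le> 1 \<longrightarrow> \<bar>g (x + h) - g x - p * h\<bar> \<le> K * h\<^sup>2"
  shows "C11 g"
proof -
  obtain p where p: "\<And>x h. \<bar>h\<bar> \<le> 1 \<Longrightarrow> \<bar>g (x + h) - g x - p x * h\<bar> \<le> K * h\<^sup>2"
    using expansion by metis
  have g_deriv: "(g has_real_derivative p x) (at x)" for x
  proof -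
    have "((\<lambda>h. (g (x + h) - g x) / h - p x) \<longlongrightarrow> 0) (at 0)"
    proof (rule Lim_null_comparison)
      show "\<forall>\<^sub>F h in at 0. norm ((g (x + h) - g x) / h - p x) \<le> K * \<bar>h\<bar>"
        unfolding eventually_at
      proof (intro exI[of _ 1] conjI ballI impI)
        fix h :: real assume h: "h \<noteq> 0 \<and> dist h 0 < 1"
        have "\<bar>(g (x + h) - g x) / h - p x\<bar> = \<bar>g (x + h) - g x - p x * h\<bar> / \<bar>h\<bar>"
          using h by (simp add: field_simps flip: abs_divide)
        also have "\<dots> \<le> K * h\<^sup>2 / \<bar>h\<bar>" using h p by (intro divide_right_mono) auto
        also have "\<dots> = K * \<bar>h\<bar>" using h by (simp add: power2_eq_square abs_if)
        finally show "norm ((g (x + h) - g x) / h - p x) \<le> K * \<bar>h\<bar>" by simp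
      qed simp
      show "((\<lambda>h. K * \<bar>h\<bar>) \<longlongrightarrow> 0) (at (0::real))" by (auto intro!: tendsto_eq_intros)
    qed
    then show ?thesis by (simp add: DERIV_def LIM_zero_iff)
  qed
  have "(2 * K)-lipschitz_on UNIV p"
  proof (rule small_scale_lipschitz_imp_lipschitz)
    fix x h :: real assume h: "\<bar>h\<bar> \<le> 1"
    \<comment> \<open>Compare the expansion at \<open>x\<close> with the one at \<open>x + h\<close> taken backwards.\<close>
    have "\<bar>p (x + h) - p x\<bar> * \<bar>h\<bar> = \<bar>(p (x + h) - p x) * h\<bar>" by (simp add: abs_mult)
    also have "\<dots> \<le> 2 * K * h\<^sup>2"
      using p[OF h, of x] p[of "- h" "x + h"] h by (simp add: algebra_simps)
    finally have "\<bar>p (x + h) - p x\<bar> * \<bar>h\<bar> \<le> (2 * K * \<bar>h\<bar>) * \<bar>h\<bar>"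
      by (simp add: power2_eq_square mult.assoc)
    then show "\<bar>p (x + h) - p x\<bar> \<le> 2 * K * \<bar>h\<bar>" by (cases "h = 0") simp_all
  qed
  moreover have "deriv g = p" using g_deriv by (auto intro!: DERIV_imp_deriv)
  ultimately show ?thesis
    unfolding C11_def using g_deriv real_differentiable_def by blast
qed

section \<open>Twisted periodic costs\<close>

text \<open>The properties of \<open>S_c\<close> that the argument needs, with derivatives replaced by finite inequalities.
  The slope \<open>p\<close> of an expansion is bound inside the quantifier over base points: this makes the
  condition visibly invariant under diagonal translations, so it can be checked on a compact set.
  The assumption \<open>twist\<close> is the bound on the mixed derivative, integrated over a rectangle.\<close>

locale twist_cost =
  fixes A :: "real \<times> real \<Rightarrow> real" and \<epsilon> :: real
  assumes diagonal_periodic: "A (x + 1, y + 1) = A (x, y)"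
    and continuous: "continuous_on UNIV A"
    and \<epsilon>_pos: "0 < \<epsilon>"
    and twist: "x \<le> x' \<Longrightarrow> z \<le> z' \<Longrightarrow>
      A (x', z') + A (x, z) + \<epsilon> * (x' - x) * (z' - z) \<le> A (x', z) + A (x, z')"
    and expansion_fst: "\<exists>K. \<forall>x y. \<bar>x - y\<bar> \<le> R \<longrightarrow>
      (\<exists>p. \<bar>p\<bar> \<le> K \<and> (\<forall>h. \<bar>h\<bar> \<le> 1 \<longrightarrow> \<bar>A (x + h, y) - A (x, y) - p * h\<bar> \<le> K * h\<^sup>2))"
    and expansion_snd: "\<exists>K. \<forall>x y. \<bar>x - y\<bar> \<le> R \<longrightarrow>
      (\<exists>p. \<bar>p\<bar> \<le> K \<and> (\<forall>h. \<bar>h\<bar> \<le> 1 \<longrightarrow> \<bar>A (x, y + h) - A (x, y) - p * h\<bar> \<le> K * h\<^sup>2))"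
begin

lemma uncrossing:
  assumes "x \<le> x'" "z \<le> z'"
  shows "A (x', z') + A (x, z) \<le> A (x', z) + A (x, z')"
proof -
  have "0 \<le> \<epsilon> * (x' - x) * (z' - z)" using assms \<epsilon>_pos by simp
  then show ?thesis using twist[OF assms] by linarith
qed

lemma diagonal_periodic_nat: "A (x + real n, y + real n) = A (x, y)"
proof (induction n)
  case (Suc n)
  then show ?case using diagonal_periodic[of "x + real n" "y + real n"]
    by (simp add: algebra_simps)
qed simp

lemma diagonal_periodic_int: "A (x + of_int n, y + of_int n) = A (x, y)"
proof (cases "0 \<le> n")
  case True
  then show ?thesis using diagonal_periodic_nat[of x "nat n" y] by simp
next
  case False
  then show ?thesis
    using diagonal_periodic_nat[of "x + of_int n" "nat (- n)" "y + of_int n"] by simp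
qed

lemma bounded_near_diagonal: "\<exists>C. \<forall>x y. \<bar>x - y\<bar> \<le> R \<longrightarrow> \<bar>A (x, y)\<bar> \<le> C"
proof -
  have "compact (A ` ({0..1} \<times> {- R..1 + R}))"
    by (intro compact_continuous_image compact_Times compact_Icc
        continuous_on_subset[OF continuous]) auto
  then obtain C where C: "\<And>a. a \<in> A ` ({0..1} \<times> {- R..1 + R}) \<Longrightarrow> norm a \<le> C"
    using compact_imp_bounded bounded_iff by metis
  have "\<bar>A (x, y)\<bar> \<le> C" if "\<bar>x - y\<bar> \<le> R" for x y
  proof -
    define n where "n = \<lfloor>x\<rfloor>"
    have "(x - of_int n, y - of_int n) \<in> {0..1} \<times> {- R..1 + R}"
      using that unfolding n_def by (auto, linarith+)
    then have "\<bar>A (x - of_int n, y - of_int n)\<bar> \<le> C" using C by fastforce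
    then show ?thesis using diagonal_periodic_int[of "x - of_int n" n "y - of_int n"] by simp
  qed
  then show ?thesis by blast
qed

lemma quadratic_growth_nat:
  fixes b :: "nat \<Rightarrow> real"
  assumes convex: "\<And>n. b n + b (n + 2) \<ge> 2 * b (n + 1) + \<epsilon>"
  shows "b n \<ge> b 0 + real n * (b 1 - b 0) + \<epsilon> * (real n * (real n - 1)) / 2"
proof -
  have incr: "b (Suc n) - b n \<ge> b 1 - b 0 + real n * \<epsilon>" for n
  proof (induction n)
    case (Suc n)
    then show ?case using convex[of n] by (simp add: algebra_simps)
  qed simp
  show ?thesis
  proof (induction n)
    case (Suc n)
    then show ?case using incr[of n] by (simp add: field_simps)
  qed simp
qed

text \<open>This is the twist inequality on a unit square: by diagonal periodicity both corners of its diagonal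
  have the same value of \<open>A\<close>.\<close>

lemma second_difference: "A (x, z + 1) + A (x, z - 1) \<ge> 2 * A (x, z) + \<epsilon>"
  using twist[of x "x + 1" z "z + 1"] diagonal_periodic[of x z] diagonal_periodic[of x "z - 1"]
  by simp

text \<open>After splitting off the integer part of \<open>y - x\<close>, the values of \<open>A (x, _)\<close> form a sequence with
  bounded first two terms and second differences at least \<open>\<epsilon>\<close>, so they grow quadratically. Both
  directions \<open>y \<rightarrow> \<plusminus>\<infinity>\<close> are instances of the same estimate on sequences.\<close>

lemma coercive: "\<exists>R. \<forall>x y. A (x, y) \<le> M \<longrightarrow> \<bar>x - y\<bar> \<le> R"
proof -
  obtain C where C: "\<And>x y. \<bar>x - y\<bar> \<le> 2 \<Longrightarrow> \<bar>A (x, y)\<bar> \<le> C"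
    using bounded_near_diagonal[of 2] by blast
  have C0: "0 \<le> C" using C[of 0 0] by simp
  \<comment> \<open>If \<open>n > Q + 1\<close>, the quadratic term beats \<open>(3C + |M| + 1) n\<close>, hence the linear loss \<open>2Cn\<close>, the
    initial value and \<open>M\<close> together.\<close>
  define Q where "Q = 2 * (3 * C + \<bar>M\<bar> + 1) / \<epsilon>"
  have Q0: "0 \<le> Q" using C0 \<epsilon>_pos by (simp add: Q_def)
  have small: "real n \<le> Q + 1"
    if conv: "\<And>n. b n + b (n + 2) \<ge> 2 * b (n + 1) + \<epsilon>"
      and b: "\<bar>b 0\<bar> \<le> C" "\<bar>b 1\<bar> \<le> C" "b n \<le> M" for b :: "nat \<Rightarrow> real" and n
  proof (rule ccontr)
    assume "\<not> ?thesis"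
    then have n: "real n - 1 > Q" "real n \<ge> 1" using Q0 by linarith+
    have "3 * C + \<bar>M\<bar> + 1 = \<epsilon> * Q / 2" using \<epsilon>_pos by (simp add: Q_def)
    also have "\<dots> \<le> \<epsilon> * (real n - 1) / 2" using n \<epsilon>_pos by simp
    finally have "real n * (3 * C + \<bar>M\<bar> + 1) \<le> real n * (\<epsilon> * (real n - 1) / 2)"
      by (intro mult_left_mono) auto
    moreover have "real n * (3 * C + \<bar>M\<bar> + 1) = real n * (C + \<bar>M\<bar> + 1) - real n * (- 2 * C)"
      by (simp add: algebra_simps)
    moreover have "real n * (\<epsilon> * (real n - 1) / 2) = \<epsilon> * (real n * (real n - 1)) / 2"
      by simp
    moreover have "b n \<ge> b 0 + real n * (b 1 - b 0) + \<epsilon> * (real n * (real n - 1)) / 2"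
      using quadratic_growth_nat[of b n] conv by blast
    moreover have "real n * (b 1 - b 0) \<ge> real n * (- 2 * C)"
      using b by (intro mult_left_mono) auto
    moreover have "real n * (C + \<bar>M\<bar> + 1) \<ge> 1 * (C + \<bar>M\<bar> + 1)"
      using n C0 by (intro mult_right_mono) auto
    ultimately show False using b by argo
  qed
  have "\<bar>x - y\<bar> \<le> Q + 2" if M: "A (x, y) \<le> M" for x y
  proof (cases "x \<le> y")
    case True
    define n where "n = nat \<lfloor>y - x\<rfloor>"
    define r where "r = y - real n"
    have r: "\<bar>x - r\<bar> \<le> 1" "\<bar>y - x\<bar> \<le> real n + 1" using True
      by (simp_all add: r_def n_def abs_if, linarith+)
    have "real n \<le> Q + 1"
    proof (rule small[where b = "\<lambda>k. A (x, r + real k)"])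
      show "A (x, r + real k) + A (x, r + real (k + 2)) \<ge> 2 * A (x, r + real (k + 1)) + \<epsilon>" for k
        using second_difference[of x "r + real (k + 1)"] by (simp add: algebra_simps)
    qed (use r M in \<open>auto intro!: C simp: r_def\<close>)
    then show ?thesis using r by linarith
  next
    case False
    define n where "n = nat \<lfloor>x - y\<rfloor>"
    define r where "r = y + real n"
    have r: "\<bar>x - r\<bar> \<le> 1" "\<bar>y - x\<bar> \<le> real n + 1" using False
      by (simp_all add: r_def n_def abs_if, linarith+)
    have "real n \<le> Q + 1"
    proof (rule small[where b = "\<lambda>k. A (x, r - real k)"])
      show "A (x, r - real k) + A (x, r - real (k + 2)) \<ge> 2 * A (x, r - real (k + 1)) + \<epsilon>" for k
        using second_difference[of x "r - real (k + 1)"] by (simp add: algebra_simps)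
    qed (use r M in \<open>auto intro!: C simp: r_def\<close>)
    then show ?thesis using r by linarith
  qed
  then show ?thesis by blast
qed

lemma bounded_below: "\<exists>m. \<forall>x y. m \<le> A (x, y)"
proof -
  obtain R where R: "\<And>x y. A (x, y) \<le> 0 \<Longrightarrow> \<bar>x - y\<bar> \<le> R" using coercive by blast
  obtain C where C: "\<And>x y. \<bar>x - y\<bar> \<le> R \<Longrightarrow> \<bar>A (x, y)\<bar> \<le> C"
    using bounded_near_diagonal by blast
  have "min 0 (- C) \<le> A (x, y)" for x y
    using R[of x y] C[of x y] by (cases "A (x, y) \<le> 0") auto
  then show ?thesis by blast
qed

section \<open>The backward operator\<close>

definition backward :: "(real \<Rightarrow> real) \<Rightarrow> real \<Rightarrow> real"
  where "backward u x = (INF y. u y + A (y, x))"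

definition forward :: "(real \<Rightarrow> real) \<Rightarrow> real \<Rightarrow> real"
  where "forward u x = (SUP y. u y - A (x, y))"

lemma bdd_below_backward:
  assumes "bounded (range u)"
  shows "bdd_below (range (\<lambda>y. u y + A (y, x)))"
proof -
  obtain B where B: "\<And>y. \<bar>u y\<bar> \<le> B" using assms by (auto simp: bounded_iff)
  obtain m where m: "\<And>x y. m \<le> A (x, y)" using bounded_below by blast
  have "- B + m \<le> u y + A (y, x)" for y using B[of y] m[of y x] by (simp add: abs_if split: if_splits)
  then show ?thesis by (auto intro!: bdd_belowI)
qed

lemma backward_le:
  assumes "bounded (range u)"
  shows "backward u x \<le> u y + A (y, x)"
  unfolding backward_def by (intro cINF_lower bdd_below_backward assms) simp

lemma near_minimizer:
  assumes "bounded (range u)" "0 < \<eta>"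
  obtains y where "u y + A (y, x) < backward u x + \<eta>"
proof -
  have "(INF y. u y + A (y, x)) < backward u x + \<eta>" using assms by (simp add: backward_def)
  then show ?thesis
    using that by (subst (asm) cINF_less_iff) (auto intro: bdd_below_backward assms)
qed

lemma bounded_backward:
  assumes u: "bounded (range u)"
  shows "bounded (range (backward u))"
proof -
  obtain B where B: "\<And>y. \<bar>u y\<bar> \<le> B" using u by (auto simp: bounded_iff)
  obtain m where m: "\<And>x y. m \<le> A (x, y)" using bounded_below by blast
  obtain C where C: "\<And>x y. \<bar>x - y\<bar> \<le> 0 \<Longrightarrow> \<bar>A (x, y)\<bar> \<le> C"
    using bounded_near_diagonal by blast
  have "- B + m \<le> backward u x" for x
    unfolding backward_def
  proof (rule cINF_greatest)
    show "- B + m \<le> u y + A (y, x)" for y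
      using B[of y] m[of y x] by (simp add: abs_if split: if_splits)
  qed simp
  moreover have "backward u x \<le> B + C" for x
    using backward_le[OF u, of x x] B[of x] C[of x x] by (simp add: abs_if split: if_splits)
  ultimately have "range (backward u) \<subseteq> {- B + m..B + C}" by auto
  then show ?thesis using bounded_closed_interval bounded_subset by blast
qed

text \<open>Although \<open>u\<close> need not be continuous and the infimum need not be attained, approximate minimizers
  stay close to the diagonal; there the expansions of \<open>A\<close> are uniform.\<close>

lemma near_minimizers_near_diagonal:
  assumes u: "bounded (range u)"
  shows "\<exists>R. \<forall>x y. u y + A (y, x) \<le> backward u x + 1 \<longrightarrow> \<bar>y - x\<bar> \<le> R"
proof -
  obtain B where B: "\<And>y. \<bar>u y\<bar> \<le> B" using u by (auto simp: bounded_iff)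
  obtain D where D: "\<And>y. \<bar>backward u y\<bar> \<le> D"
    using bounded_backward[OF u] by (auto simp: bounded_iff)
  obtain R where R: "\<And>x y. A (x, y) \<le> D + 1 + B \<Longrightarrow> \<bar>x - y\<bar> \<le> R" using coercive by blast
  have "\<bar>y - x\<bar> \<le> R" if "u y + A (y, x) \<le> backward u x + 1" for x y
    by (rule R) (use that B[of y] D[of x] in linarith)
  then show ?thesis by blast
qed

text \<open>A single approximate minimizer \<open>y\<close> for \<open>t\<close> bounds the values at \<open>t + h\<close> and at \<open>t - h\<close> from above; in
  the symmetric sum the slope of \<open>A (y, _)\<close>, which depends on \<open>y\<close>, cancels.\<close>

lemma semiconcave_backward:
  assumes u: "bounded (range u)"
  shows "\<exists>K. \<forall>t h. \<bar>h\<bar> \<le> 1 \<longrightarrow>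
    backward u (t + h) + backward u (t - h) \<le> 2 * backward u t + K * h\<^sup>2"
proof -
  obtain R where R: "\<And>x y. u y + A (y, x) \<le> backward u x + 1 \<Longrightarrow> \<bar>y - x\<bar> \<le> R"
    using near_minimizers_near_diagonal[OF u] by blast
  obtain K where K: "\<And>x y. \<bar>x - y\<bar> \<le> R \<Longrightarrow>
      \<exists>p. \<bar>p\<bar> \<le> K \<and> (\<forall>h. \<bar>h\<bar> \<le> 1 \<longrightarrow> \<bar>A (x, y + h) - A (x, y) - p * h\<bar> \<le> K * h\<^sup>2)"
    using expansion_snd[of R] by blast
  have "backward u (t + h) + backward u (t - h) \<le> 2 * backward u t + 2 * K * h\<^sup>2"
    if h: "\<bar>h\<bar> \<le> 1" for t h
  proof (rule field_le_epsilon)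
    fix \<eta> :: real assume "0 < \<eta>"
    then obtain y where y: "u y + A (y, t) < backward u t + min 1 (\<eta> / 2)"
      using near_minimizer[OF u, of "min 1 (\<eta> / 2)"] by auto
    then have "\<bar>y - t\<bar> \<le> R" by (intro R) auto
    then obtain p where p: "\<And>h. \<bar>h\<bar> \<le> 1 \<Longrightarrow> \<bar>A (y, t + h) - A (y, t) - p * h\<bar> \<le> K * h\<^sup>2"
      using K by blast
    show "backward u (t + h) + backward u (t - h) \<le> 2 * backward u t + 2 * K * h\<^sup>2 + \<eta>"
      using p[of h] p[of "- h"] h y backward_le[OF u, of "t + h" y] backward_le[OF u, of "t - h" y]
      by simp
  qed
  then show ?thesis by blast
qed

lemma continuous_backward:
  assumes u: "bounded (range u)"
  shows "continuous_on UNIV (backward u)"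
proof -
  obtain R where R: "\<And>x y. u y + A (y, x) \<le> backward u x + 1 \<Longrightarrow> \<bar>y - x\<bar> \<le> R"
    using near_minimizers_near_diagonal[OF u] by blast
  obtain K where K: "\<And>x y. \<bar>x - y\<bar> \<le> R \<Longrightarrow>
      \<exists>p. \<bar>p\<bar> \<le> K \<and> (\<forall>h. \<bar>h\<bar> \<le> 1 \<longrightarrow> \<bar>A (x, y + h) - A (x, y) - p * h\<bar> \<le> K * h\<^sup>2)"
    using expansion_snd[of R] by blast
  have up: "backward u (t + h) \<le> backward u t + 2 * K * \<bar>h\<bar>" if h: "\<bar>h\<bar> \<le> 1" for t h
  proof (rule field_le_epsilon)
    fix \<eta> :: real assume "0 < \<eta>"
    then obtain y where y: "u y + A (y, t) < backward u t + min 1 \<eta>"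
      using near_minimizer[OF u, of "min 1 \<eta>"] by auto
    then have "\<bar>y - t\<bar> \<le> R" by (intro R) auto
    then obtain p where "\<bar>p\<bar> \<le> K" and p: "\<bar>A (y, t + h) - A (y, t) - p * h\<bar> \<le> K * h\<^sup>2"
      using K h by blast
    have "p * h \<le> \<bar>p\<bar> * \<bar>h\<bar>" by (metis abs_ge_self abs_mult)
    also have "\<dots> \<le> K * \<bar>h\<bar>" using \<open>\<bar>p\<bar> \<le> K\<close> by (intro mult_right_mono) auto
    finally have "p * h \<le> K * \<bar>h\<bar>" .
    moreover have "K * h\<^sup>2 \<le> K * \<bar>h\<bar>"
    proof (rule mult_left_mono)
      show "h\<^sup>2 \<le> \<bar>h\<bar>" using mult_left_mono[OF h, of "\<bar>h\<bar>"] by (simp add: power2_eq_square)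
      show "0 \<le> K" using \<open>\<bar>p\<bar> \<le> K\<close> by linarith
    qed
    ultimately show "backward u (t + h) \<le> backward u t + 2 * K * \<bar>h\<bar> + \<eta>"
      using p y backward_le[OF u, of "t + h" y] by simp
  qed
  have "(2 * K)-lipschitz_on UNIV (backward u)"
  proof (rule small_scale_lipschitz_imp_lipschitz)
    fix t h :: real assume "\<bar>h\<bar> \<le> 1"
    then show "\<bar>backward u (t + h) - backward u t\<bar> \<le> 2 * K * \<bar>h\<bar>"
      using up[of h t] up[of "- h" "t + h"] by simp
  qed
  then show ?thesis by (rule lipschitz_on_continuous_on)
qed

section \<open>Minimizers\<close>

definition minimizer :: "(real \<Rightarrow> real) \<Rightarrow> real \<Rightarrow> real \<Rightarrow> bool"
  where "minimizer v z y \<longleftrightarrow> (\<forall>y'. v y + A (y, z) \<le> v y' + A (y', z))"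

lemma backward_eq_if_minimizer:
  assumes "bounded (range v)" "minimizer v z y"
  shows "backward v z = v y + A (y, z)"
proof (rule antisym)
  show "backward v z \<le> v y + A (y, z)" using assms by (rule_tac backward_le)
  show "v y + A (y, z) \<le> backward v z"
    unfolding backward_def using assms(2) by (intro cINF_greatest) (auto simp: minimizer_def)
qed

lemma minimizers_exist:
  assumes bv: "bounded (range v)" and cv: "continuous_on UNIV v"
  shows "\<exists>R. (\<forall>z. \<exists>y. minimizer v z y) \<and> (\<forall>z y. minimizer v z y \<longrightarrow> \<bar>y - z\<bar> \<le> R)"
proof -
  obtain R where R: "\<And>x y. v y + A (y, x) \<le> backward v x + 1 \<Longrightarrow> \<bar>y - x\<bar> \<le> R"
    using near_minimizers_near_diagonal[OF bv] by blast
  have ex: "\<exists>y. minimizer v z y" for z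
  proof -
    obtain y0 where y0: "v y0 + A (y0, z) < backward v z + 1"
      using near_minimizer[OF bv, of 1] by auto
    then have y0R: "y0 \<in> {z - R..z + R}" using R[of y0 z] by auto
    have "continuous_on {z - R..z + R} (\<lambda>y. v y + A (y, z))"
      by (intro continuous_intros continuous_on_compose2[OF continuous] continuous_on_subset[OF cv])
         auto
    then obtain y where y: "\<And>y'. y' \<in> {z - R..z + R} \<Longrightarrow> v y + A (y, z) \<le> v y' + A (y', z)"
      using continuous_attains_inf[of "{z - R..z + R}"] y0R by blast
    have "v y + A (y, z) \<le> v y' + A (y', z)" for y'
    proof (cases "y' \<in> {z - R..z + R}")
      case False
      then have "v y' + A (y', z) > backward v z + 1" using R[of y' z] by (force simp: abs_le_iff)
      then show ?thesis using y[OF y0R] y0 by linarith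
    qed (rule y)
    then show ?thesis by (auto simp: minimizer_def)
  qed
  have "\<bar>y - z\<bar> \<le> R" if "minimizer v z y" for z y
    using R backward_eq_if_minimizer[OF bv that] by simp
  with ex show ?thesis by blast
qed

text \<open>The set \<open>P\<close> of those \<open>z\<close> with a minimizer to the left of \<open>x\<close> and the set \<open>Q\<close> of those with a
  minimizer to the right of \<open>x\<close> are closed and cover the line. Since minimizers stay near \<open>z\<close>, moving \<open>z\<close>
  far to the left or right of \<open>x\<close> shows that neither is empty. The line being connected, they meet.\<close>

lemma bracketing_minimizers:
  assumes bv: "bounded (range v)" and cv: "continuous_on UNIV v"
  shows "\<exists>z a b. minimizer v z a \<and> minimizer v z b \<and> a \<le> x \<and> x \<le> b"
proof -
  obtain R where ex: "\<And>z. \<exists>y. minimizer v z y" and R: "\<And>z y. minimizer v z y \<Longrightarrow> \<bar>y - z\<bar> \<le> R"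
    using minimizers_exist[OF assms] by blast
  \<comment> \<open>Written with the bounded variable \<open>h = y - z\<close>, so that projecting out \<open>h\<close> keeps sets closed.\<close>
  define G where "G = {w :: real \<times> real. minimizer v (snd w) (snd w + fst w)}"
  have "closed G"
    unfolding G_def minimizer_def
    by (intro closed_Collect_all closed_Collect_le continuous_intros
        continuous_on_compose2[OF continuous] continuous_on_compose2[OF cv]) auto
  define P where "P = {z. \<exists>y. minimizer v z y \<and> y \<le> x}"
  define Q where "Q = {z. \<exists>y. minimizer v z y \<and> x \<le> y}"
  have "P = {z. \<exists>h. h \<in> {- R..R} \<and> (h, z) \<in> G \<inter> {w. snd w + fst w \<le> x}}"
  proof (intro Collect_cong iffI set_eqI; unfold P_def mem_Collect_eq)
    fix z assume "\<exists>y. minimizer v z y \<and> y \<le> x"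
    then obtain y where "minimizer v z y" "y \<le> x" by blast
    then show "\<exists>h. h \<in> {- R..R} \<and> (h, z) \<in> G \<inter> {w. snd w + fst w \<le> x}"
      using R[of z y] by (intro exI[of _ "y - z"]) (auto simp: G_def)
  qed (auto simp: G_def)
  moreover have "closed \<dots>"
    by (intro closed_compact_projection closed_Int \<open>closed G\<close> closed_Collect_le continuous_intros)
       simp
  ultimately have "closed P" by simp
  have "Q = {z. \<exists>h. h \<in> {- R..R} \<and> (h, z) \<in> G \<inter> {w. x \<le> snd w + fst w}}"
  proof (intro Collect_cong iffI set_eqI; unfold Q_def mem_Collect_eq)
    fix z assume "\<exists>y. minimizer v z y \<and> x \<le> y"
    then obtain y where "minimizer v z y" "x \<le> y" by blast
    then show "\<exists>h. h \<in> {- R..R} \<and> (h, z) \<in> G \<inter> {w. x \<le> snd w + fst w}"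
      using R[of z y] by (intro exI[of _ "y - z"]) (auto simp: G_def)
  qed (auto simp: G_def)
  moreover have "closed \<dots>"
    by (intro closed_compact_projection closed_Int \<open>closed G\<close> closed_Collect_le continuous_intros)
       simp
  ultimately have "closed Q" by simp
  have "z \<in> P \<union> Q" for z
  proof -
    obtain y where "minimizer v z y" using ex by blast
    moreover have "y \<le> x \<or> x \<le> y" by (rule linear)
    ultimately show ?thesis unfolding P_def Q_def by blast
  qed
  then have "UNIV \<subseteq> P \<union> Q" by blast
  moreover have "x - R \<in> P" unfolding P_def using ex[of "x - R"] R[of "x - R"] by force
  moreover have "x + R \<in> Q" unfolding Q_def using ex[of "x + R"] R[of "x + R"] by force
  ultimately have "P \<inter> Q \<noteq> {}"
    using connected_UNIV[where 'a = real] \<open>closed P\<close> \<open>closed Q\<close>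
    unfolding connected_closed by blast
  then show ?thesis unfolding P_def Q_def by blast
qed

section \<open>The forward operator after the backward one\<close>

lemma bdd_above_forward_backward:
  assumes "bounded (range v)"
  shows "bdd_above (range (\<lambda>z. backward v z - A (x, z)))"
proof (intro bdd_aboveI2)
  show "backward v z - A (x, z) \<le> v x" for z using backward_le[OF assms, of z x] by simp
qed

lemma forward_backward_le:
  assumes "bounded (range v)"
  shows "forward (backward v) x \<le> v x"
  unfolding forward_def
  by (rule cSUP_least) (use backward_le[OF assms, of _ x] in \<open>auto simp: algebra_simps\<close>)

lemma forward_backward_ge:
  assumes "bounded (range v)"
  shows "backward v z - A (x, z) \<le> forward (backward v) x"
  unfolding forward_def by (rule cSUP_upper[OF _ bdd_above_forward_backward[OF assms]]) simp

text \<open>To see that no \<open>z'\<close> beats \<open>z\<close> in the supremum at \<open>t\<close>, test \<open>backward v z'\<close> with the minimizer lying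
  on the same side of \<open>t\<close> as \<open>z'\<close> lies of \<open>z\<close>; the twist condition then transports the comparison
  from that minimizer to \<open>t\<close>.\<close>

lemma forward_backward_between_minimizers:
  assumes bv: "bounded (range v)"
    and a: "minimizer v z a" and b: "minimizer v z b" and t: "a \<le> t" "t \<le> b"
  shows "forward (backward v) t = backward v z - A (t, z)"
proof (rule antisym)
  show "forward (backward v) t \<le> backward v z - A (t, z)"
    unfolding forward_def
  proof (rule cSUP_least)
    fix z'
    show "backward v z' - A (t, z') \<le> backward v z - A (t, z)"
    proof (cases "z \<le> z'")
      case True
      then have "A (b, z') + A (t, z) \<le> A (b, z) + A (t, z')"
        by (rule uncrossing[OF t(2)])
      then show ?thesis
        using backward_le[OF bv, of z' b] backward_eq_if_minimizer[OF bv b] by simp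
    next
      case False
      then have "A (t, z) + A (a, z') \<le> A (t, z') + A (a, z)"
        using uncrossing[OF t(1), of z' z] by simp
      then show ?thesis
        using backward_le[OF bv, of z' a] backward_eq_if_minimizer[OF bv a] by simp
    qed
  qed simp
qed (rule forward_backward_ge[OF bv])

text \<open>The constants: \<open>K\<close> is the semiconcavity of \<open>v\<close>, and \<open>L\<close> bounds the quadratic error of a barrier
  \<open>\<phi>\<close>. The excess of \<open>\<psi>\<close> over \<open>\<phi>\<close> costs \<open>K + 2 L\<close>, and expanding \<open>\<phi>\<close> at \<open>x\<close> costs
  another \<open>L\<close>.\<close>

lemma C11_forward_backward_if_semiconcave:
  assumes bv: "bounded (range v)" and cv: "continuous_on UNIV v"
    and semiconcave: "\<And>t h. \<bar>h\<bar> \<le> 1 \<Longrightarrow> v (t + h) + v (t - h) \<le> 2 * v t + K * h\<^sup>2"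
  shows "C11 (forward (backward v))"
proof -
  obtain R where R: "\<And>z y. minimizer v z y \<Longrightarrow> \<bar>y - z\<bar> \<le> R"
    using minimizers_exist[OF bv cv] by blast
  obtain L where L: "\<And>x y. \<bar>x - y\<bar> \<le> R \<Longrightarrow>
      \<exists>p. \<bar>p\<bar> \<le> L \<and> (\<forall>h. \<bar>h\<bar> \<le> 1 \<longrightarrow> \<bar>A (x + h, y) - A (x, y) - p * h\<bar> \<le> L * h\<^sup>2)"
    using expansion_fst[of R] by blast
  \<comment> \<open>At a minimizer \<open>v\<close> is touched from below by a barrier, which bounds how concave it can be.\<close>
  have K0: "0 \<le> K + 2 * L"
  proof -
    obtain z y where y: "minimizer v z y" using minimizers_exist[OF bv cv] by blast
    then obtain p where p: "\<And>h. \<bar>h\<bar> \<le> 1 \<Longrightarrow> \<bar>A (y + h, z) - A (y, z) - p * h\<bar> \<le> L * h\<^sup>2"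
      using L R by blast
    have "v y + A (y, z) \<le> v (y + 1) + A (y + 1, z)" "v y + A (y, z) \<le> v (y - 1) + A (y - 1, z)"
      using y unfolding minimizer_def by blast+
    then show ?thesis
      using semiconcave[of 1 y] p[of 1] p[of "- 1"] by (simp add: abs_le_iff)
  qed
  \<comment> \<open>The barrier bounds \<open>v (y - k)\<close> from below, so semiconcavity bounds \<open>v (y + k)\<close> from above.\<close>
  have touch: "v (y + k) \<le> backward v z - A (y + k, z) + (K + 2 * L) * k\<^sup>2"
    if y: "minimizer v z y" and k: "\<bar>k\<bar> \<le> 1" for z y k
  proof -
    obtain p where p: "\<And>h. \<bar>h\<bar> \<le> 1 \<Longrightarrow> \<bar>A (y + h, z) - A (y, z) - p * h\<bar> \<le> L * h\<^sup>2"
      using L R[OF y] by blast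
    have "v (y + k) + v (y - k) \<le> 2 * v y + K * k\<^sup>2" using semiconcave[OF k] .
    moreover have "backward v z \<le> v (y - k) + A (y - k, z)" using backward_le[OF bv] .
    moreover have "backward v z = v y + A (y, z)" using backward_eq_if_minimizer[OF bv y] .
    ultimately show ?thesis
      using p[of k] p[of "- k"] k by (simp add: algebra_simps abs_le_iff)
  qed
  have "\<exists>p. \<forall>h. \<bar>h\<bar> \<le> 1 \<longrightarrow>
      \<bar>forward (backward v) (x + h) - forward (backward v) x - p * h\<bar> \<le> (K + 3 * L) * h\<^sup>2" for x
  proof -
    obtain z a b where a: "minimizer v z a" and b: "minimizer v z b" and x: "a \<le> x" "x \<le> b"
      using bracketing_minimizers[OF bv cv] by blast
    have "\<bar>x - z\<bar> \<le> R" using R[OF a] R[OF b] x by linarith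
    then obtain p where p: "\<And>h. \<bar>h\<bar> \<le> 1 \<Longrightarrow> \<bar>A (x + h, z) - A (x, z) - p * h\<bar> \<le> L * h\<^sup>2"
      using L by blast
    have "\<bar>forward (backward v) (x + h) - forward (backward v) x - (- p) * h\<bar> \<le> (K + 3 * L) * h\<^sup>2"
      if h: "\<bar>h\<bar> \<le> 1" for h
    proof -
      define \<phi> where "\<phi> t = backward v z - A (t, z)" for t
      have at_x: "forward (backward v) x = \<phi> x"
        unfolding \<phi>_def by (rule forward_backward_between_minimizers[OF bv a b x])
      have lower: "\<phi> (x + h) \<le> forward (backward v) (x + h)"
        unfolding \<phi>_def by (rule forward_backward_ge[OF bv])
      have beyond: "forward (backward v) (x + h) \<le> \<phi> (x + h) + (K + 2 * L) * h\<^sup>2"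
        if y: "minimizer v z y" and dist: "\<bar>x + h - y\<bar> \<le> \<bar>h\<bar>" for y
      proof -
        have "forward (backward v) (x + h) \<le> v (x + h)" by (rule forward_backward_le[OF bv])
        also have "\<dots> \<le> \<phi> (x + h) + (K + 2 * L) * (x + h - y)\<^sup>2"
          using touch[OF y, of "x + h - y"] dist h unfolding \<phi>_def by simp
        also have "\<dots> \<le> \<phi> (x + h) + (K + 2 * L) * h\<^sup>2"
          using dist K0 by (intro add_left_mono mult_left_mono) (simp_all add: abs_le_square_iff)
        finally show ?thesis .
      qed
      have "forward (backward v) (x + h) \<le> \<phi> (x + h) + (K + 2 * L) * h\<^sup>2"
      proof -
        consider "b < x + h" | "x + h < a" | "a \<le> x + h" "x + h \<le> b" by linarith
        then show ?thesis
        proof cases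
          case 1 then show ?thesis using beyond[OF b] x by linarith
        next
          case 2 then show ?thesis using beyond[OF a] x by linarith
        next
          case 3
          then have "forward (backward v) (x + h) = \<phi> (x + h)"
            unfolding \<phi>_def by (rule forward_backward_between_minimizers[OF bv a b])
          then show ?thesis using K0 by simp
        qed
      qed
      moreover have "\<bar>\<phi> (x + h) - \<phi> x + p * h\<bar> \<le> L * h\<^sup>2"
        using p[OF h] by (simp add: \<phi>_def abs_le_iff)
      moreover have "0 \<le> (K + 2 * L) * h\<^sup>2" using K0 by simp
      ultimately show ?thesis using lower at_x
        by (simp add: abs_le_iff algebra_simps)
    qed
    then show ?thesis by blast
  qed
  then show ?thesis by (rule C11_if_quadratic_expansion)
qed

lemma C11_forward_backward_backward:
  assumes "bounded (range u)"
  shows "C11 (forward (backward (backward u)))"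
proof -
  obtain K where "\<And>t h. \<bar>h\<bar> \<le> 1 \<Longrightarrow>
      backward u (t + h) + backward u (t - h) \<le> 2 * backward u t + K * h\<^sup>2"
    using semiconcave_backward[OF assms] by blast
  then show ?thesis
    by (intro C11_forward_backward_if_semiconcave[where K = K]
        bounded_backward continuous_backward assms)
qed

end

section \<open>Generating functions are twisted costs\<close>

text \<open>Second-order Taylor estimates in a fixed direction \<open>e\<close> are uniform on a compact set, and a diagonal
  translation brings every point of a strip around the diagonal into one.\<close>

lemma C2_periodic_expansion:
  fixes S :: "real \<times> real \<Rightarrow> real" and e :: "real \<times> real"
  assumes C2: "C2_on UNIV S" and periodic: "\<And>x y. S (x + 1, y + 1) = S (x, y)"
  shows "\<exists>K. \<forall>x y. \<bar>x - y\<bar> \<le> R \<longrightarrow>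
    (\<exists>p. \<bar>p\<bar> \<le> K \<and> (\<forall>h. \<bar>h\<bar> \<le> 1 \<longrightarrow> \<bar>S ((x, y) + h *\<^sub>R e) - S (x, y) - p * h\<bar> \<le> K * h\<^sup>2))"
proof -
  obtain g' where g': "\<And>z. (S has_derivative blinfun_apply (g' z)) (at z)"
    and C1: "C1_on UNIV g'" using C2 unfolding C2_on_def by blast
  obtain g'' where g'': "\<And>z. (g' has_derivative blinfun_apply (g'' z)) (at z)"
    and cont'': "continuous_on UNIV g''" using C1 unfolding C1_on_def by blast
  have cont': "continuous_on UNIV g'"
    using has_derivative_continuous[OF g''] by (intro continuous_at_imp_continuous_on) simp
  define Q where "Q = cball (0 :: real \<times> real) (2 + \<bar>R\<bar> + norm e)"
  have "bounded ((\<lambda>z. g' z e) ` Q)"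
    unfolding Q_def
    by (intro compact_imp_bounded compact_continuous_image compact_cball continuous_intros
        continuous_on_subset[OF cont']) auto
  then obtain K1 where K1: "\<And>z. z \<in> Q \<Longrightarrow> \<bar>g' z e\<bar> \<le> K1"
    by (auto simp: bounded_iff)
  have "bounded ((\<lambda>z. (g'' z e) e) ` Q)"
    unfolding Q_def
    by (intro compact_imp_bounded compact_continuous_image compact_cball continuous_intros
        continuous_on_subset[OF cont'']) auto
  then obtain K2 where K2: "\<And>z. z \<in> Q \<Longrightarrow> \<bar>(g'' z e) e\<bar> \<le> K2"
    by (auto simp: bounded_iff)
  have main: "\<bar>g' z e\<bar> \<le> max K1 K2 \<and>
      (\<forall>h. \<bar>h\<bar> \<le> 1 \<longrightarrow> \<bar>S (z + h *\<^sub>R e) - S z - g' z e * h\<bar> \<le> max K1 K2 * h\<^sup>2)"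
    if z: "norm z \<le> 2 + \<bar>R\<bar>" for z
  proof (intro conjI allI impI)
    have line: "z + s *\<^sub>R e \<in> Q" if "\<bar>s\<bar> \<le> 1" for s
    proof -
      have "norm (z + s *\<^sub>R e) \<le> norm z + \<bar>s\<bar> * norm e"
        using norm_triangle_ineq[of z "s *\<^sub>R e"] by simp
      also have "\<bar>s\<bar> * norm e \<le> 1 * norm e" using that by (intro mult_right_mono) auto
      finally show ?thesis using z by (simp add: Q_def)
    qed
    show "\<bar>g' z e\<bar> \<le> max K1 K2" using K1[of z] line[of 0] by simp
    fix h :: real assume h: "\<bar>h\<bar> \<le> 1"
    have d1: "((\<lambda>s. S (z + s *\<^sub>R e)) has_real_derivative g' (z + s *\<^sub>R e) e) (at s)" for s
    proof -
      have "((\<lambda>s. S (z + s *\<^sub>R e)) has_derivative (\<lambda>k. g' (z + s *\<^sub>R e) (k *\<^sub>R e))) (at s)"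
        by (rule has_derivative_compose[OF _ g']) (auto intro!: derivative_eq_intros)
      then show ?thesis
        by (simp add: has_field_derivative_def blinfun.scaleR_right
            mult.commute[of _ "blinfun_apply _ _"])
    qed
    have d2: "((\<lambda>s. g' (z + s *\<^sub>R e) e) has_real_derivative (g'' (z + s *\<^sub>R e) e) e) (at s)" for s
    proof -
      have "((\<lambda>s. g' (z + s *\<^sub>R e)) has_derivative (\<lambda>k. g'' (z + s *\<^sub>R e) (k *\<^sub>R e))) (at s)"
        by (rule has_derivative_compose[OF _ g'']) (auto intro!: derivative_eq_intros)
      then have "((\<lambda>s. g' (z + s *\<^sub>R e) e) has_derivative (\<lambda>k. g'' (z + s *\<^sub>R e) (k *\<^sub>R e) e)) (at s)"
        by (rule bounded_linear.has_derivative[OF blinfun.bounded_linear_left])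
      then show ?thesis
        by (simp add: has_field_derivative_def blinfun.scaleR_right blinfun.scaleR_left
            mult.commute[of _ "blinfun_apply _ _"])
    qed
    have e1: "\<bar>g' (z + s *\<^sub>R e) e - g' z e\<bar> \<le> K2 * \<bar>h\<bar>" if s: "s \<in> cball 0 \<bar>h\<bar>" for s
    proof -
      have "norm (g' (z + s *\<^sub>R e) e - g' (z + 0 *\<^sub>R e) e) \<le> K2 * norm (s - 0)"
        by (rule field_differentiable_bound[of "cball 0 \<bar>h\<bar>"])
           (use s h in \<open>auto intro!: K2 line has_field_derivative_at_within[OF d2]\<close>)
      also have "\<dots> \<le> K2 * \<bar>h\<bar>"
        using s K2[OF line[of 0]] by (intro mult_left_mono) auto
      finally show ?thesis by simp
    qed
    have "norm ((S (z + h *\<^sub>R e) - g' z e * h) - (S (z + 0 *\<^sub>R e) - g' z e * 0))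
        \<le> (K2 * \<bar>h\<bar>) * norm (h - 0)"
    proof (rule field_differentiable_bound[of "cball 0 \<bar>h\<bar>" "\<lambda>s. S (z + s *\<^sub>R e) - g' z e * s"
          "\<lambda>s. g' (z + s *\<^sub>R e) e - g' z e"])
      show "((\<lambda>s. S (z + s *\<^sub>R e) - g' z e * s) has_field_derivative g' (z + s *\<^sub>R e) e - g' z e)
          (at s within cball 0 \<bar>h\<bar>)" for s
        by (auto intro!: derivative_eq_intros has_field_derivative_at_within[OF d1])
    qed (use e1 in auto)
    also have "\<dots> = K2 * h\<^sup>2" by (simp add: power2_eq_square)
    also have "\<dots> \<le> max K1 K2 * h\<^sup>2" by (intro mult_right_mono) auto
    finally show "\<bar>S (z + h *\<^sub>R e) - S z - g' z e * h\<bar> \<le> max K1 K2 * h\<^sup>2"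
      by (simp add: algebra_simps)
  qed
  have nat_shift: "S (z + real n *\<^sub>R (1, 1)) = S z" for z n
  proof (induction n)
    case (Suc n)
    then show ?case using periodic[of "fst z + real n" "snd z + real n"]
      by (cases z) (simp add: algebra_simps)
  qed (simp flip: zero_prod_def)
  have shift: "S (z + of_int n *\<^sub>R (1, 1)) = S z" for z n
  proof (cases "0 \<le> n")
    case True
    then show ?thesis using nat_shift[of z "nat n"] by simp
  next
    case False
    then show ?thesis using nat_shift[of "z + of_int n *\<^sub>R (1, 1)" "nat (- n)"]
      by (simp add: algebra_simps flip: zero_prod_def)
  qed
  show ?thesis
  proof (rule exI[of _ "max K1 K2"], intro allI impI)
    fix x y :: real assume xy: "\<bar>x - y\<bar> \<le> R"
    define n where "n = - \<lfloor>x\<rfloor>"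
    define z where "z = (x, y) + of_int n *\<^sub>R (1, 1)"
    have "norm z \<le> \<bar>fst z\<bar> + \<bar>snd z\<bar>" using norm_Pair_le[of "fst z" "snd z"] by simp
    moreover have "\<bar>fst z\<bar> \<le> 1" by (simp add: z_def n_def abs_le_iff) linarith
    moreover have "\<bar>fst z - snd z\<bar> \<le> R" using xy by (simp add: z_def)
    ultimately have "norm z \<le> 2 + \<bar>R\<bar>" by linarith
    moreover have "S z = S (x, y)" unfolding z_def by (rule shift)
    moreover have "S (z + h *\<^sub>R e) = S ((x, y) + h *\<^sub>R e)" for h
    proof -
      have "z + h *\<^sub>R e = ((x, y) + h *\<^sub>R e) + of_int n *\<^sub>R (1, 1)"
        unfolding z_def by (simp only: ac_simps)
      then show ?thesis by (simp only: shift)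
    qed
    ultimately show "\<exists>p. \<bar>p\<bar> \<le> max K1 K2 \<and>
        (\<forall>h. \<bar>h\<bar> \<le> 1 \<longrightarrow> \<bar>S ((x, y) + h *\<^sub>R e) - S (x, y) - p * h\<bar> \<le> max K1 K2 * h\<^sup>2)"
      using main by metis
  qed
qed

lemma C2_on_partial2_derivatives:
  assumes "C2_on UNIV S"
  shows "((\<lambda>t. S (x, t)) has_real_derivative partial2 S (x, y)) (at y)"
    and "((\<lambda>s. partial2 S (s, y)) has_real_derivative partial1 (partial2 S) (x, y)) (at x)"
proof -
  obtain g' where g': "\<And>z. (S has_derivative blinfun_apply (g' z)) (at z)"
    and C1: "C1_on UNIV g'" using assms unfolding C2_on_def by blast
  obtain g'' where g'': "\<And>z. (g' has_derivative blinfun_apply (g'' z)) (at z)"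
    using C1 unfolding C1_on_def by blast
  have d2: "((\<lambda>t. S (x, t)) has_real_derivative g' (x, y) (0, 1)) (at y)" for x y
  proof -
    have "((\<lambda>t. S (x, t)) has_derivative (\<lambda>k. g' (x, y) (0, k))) (at y)"
      by (rule has_derivative_compose[OF _ g']) (auto intro!: derivative_eq_intros)
    moreover have "(\<lambda>k. g' (x, y) (0, k)) = (\<lambda>k. g' (x, y) (0, 1) * k)"
    proof
      show "g' (x, y) (0, k) = g' (x, y) (0, 1) * k" for k
        using blinfun.scaleR_right[of "g' (x, y)" k "(0, 1)"] by (simp add: mult.commute)
    qed
    ultimately show ?thesis
      unfolding has_field_derivative_def by (rule has_derivative_eq_rhs)
  qed
  then have p2: "partial2 S (x, y) = g' (x, y) (0, 1)" for x y
    unfolding partial2_def by (simp add: DERIV_imp_deriv)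
  show "((\<lambda>t. S (x, t)) has_real_derivative partial2 S (x, y)) (at y)"
    using d2 by (simp add: p2)
  have "((\<lambda>s. g' (s, y)) has_derivative (\<lambda>k. g'' (x, y) (k, 0))) (at x)"
    by (rule has_derivative_compose[OF _ g'']) (auto intro!: derivative_eq_intros)
  then have "((\<lambda>s. g' (s, y) (0, 1)) has_derivative (\<lambda>k. g'' (x, y) (k, 0) (0, 1))) (at x)"
    by (rule bounded_linear.has_derivative[OF blinfun.bounded_linear_left])
  moreover have "(\<lambda>k. g'' (x, y) (k, 0) (0, 1)) = (\<lambda>k. g'' (x, y) (1, 0) (0, 1) * k)"
  proof
    show "g'' (x, y) (k, 0) (0, 1) = g'' (x, y) (1, 0) (0, 1) * k" for k
      using blinfun.scaleR_right[of "g'' (x, y)" k "(1, 0)"]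
      by (simp add: blinfun.scaleR_left mult.commute)
  qed
  ultimately have "((\<lambda>s. partial2 S (s, y)) has_real_derivative g'' (x, y) (1, 0) (0, 1)) (at x)"
    unfolding has_field_derivative_def p2 by (rule has_derivative_eq_rhs)
  then show "((\<lambda>s. partial2 S (s, y)) has_real_derivative partial1 (partial2 S) (x, y)) (at x)"
    by (simp add: partial1_def DERIV_imp_deriv)
qed

text \<open>Integration of the mixed derivative over \<open>[x, x'] \<times> [z, z']\<close>, done as two monotonicity arguments,
  one in each variable.\<close>

lemma twist_inequality:
  assumes C2: "C2_on UNIV S" and mixed: "\<And>x y. partial1 (partial2 S) (x, y) < - \<epsilon>"
    and le: "x \<le> x'" "z \<le> z'"
  shows "S (x', z') + S (x, z) + \<epsilon> * (x' - x) * (z' - z) \<le> S (x', z) + S (x, z')"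
proof -
  have slope: "partial2 S (x', t) + \<epsilon> * x' \<le> partial2 S (x, t) + \<epsilon> * x" for t
  proof (rule DERIV_nonpos_imp_nonincreasing[OF le(1)])
    fix s
    have "((\<lambda>s. partial2 S (s, t) + \<epsilon> * s) has_real_derivative
        partial1 (partial2 S) (s, t) + \<epsilon>) (at s)"
      by (auto intro!: derivative_eq_intros C2_on_partial2_derivatives(2)[OF C2])
    then show "\<exists>d. ((\<lambda>s. partial2 S (s, t) + \<epsilon> * s) has_real_derivative d) (at s) \<and> d \<le> 0"
      using mixed[of s t] by (intro exI conjI) (assumption, linarith)
  qed
  have "S (x', z') - S (x, z') + \<epsilon> * (x' - x) * z' \<le> S (x', z) - S (x, z) + \<epsilon> * (x' - x) * z"
  proof (rule DERIV_nonpos_imp_nonincreasing[OF le(2)])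
    fix t
    have "((\<lambda>t. S (x', t) - S (x, t) + \<epsilon> * (x' - x) * t) has_real_derivative
        partial2 S (x', t) - partial2 S (x, t) + \<epsilon> * (x' - x)) (at t)"
      by (auto intro!: derivative_eq_intros C2_on_partial2_derivatives(1)[OF C2])
    then show "\<exists>d. ((\<lambda>t. S (x', t) - S (x, t) + \<epsilon> * (x' - x) * t) has_real_derivative d) (at t)
        \<and> d \<le> 0"
      using slope[of t] by (intro exI conjI) (assumption, simp add: algebra_simps)
  qed
  then show ?thesis by (simp add: algebra_simps)
qed

lemma twist_cost_S_c:
  assumes "generating_function S F"
  shows "\<exists>\<epsilon>. twist_cost (S_c S c) \<epsilon>"
proof -
  have C2: "C2_on UNIV S" and periodic: "\<And>x y. S (x + 1, y + 1) = S (x, y)"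
    using assms by (auto simp: generating_function_def)
  obtain \<epsilon> where \<epsilon>: "0 < \<epsilon>" "\<And>x y. partial1 (partial2 S) (x, y) < - \<epsilon>"
    using assms unfolding generating_function_def by blast
  have "twist_cost (S_c S c) \<epsilon>"
  proof
    show "S_c S c (x + 1, y + 1) = S_c S c (x, y)" for x y
      using periodic by (simp add: S_c_def)
    obtain g' where g': "\<And>z. (S has_derivative blinfun_apply (g' z)) (at z)"
      using C2 unfolding C2_on_def by blast
    have "continuous_on UNIV S"
      using has_derivative_continuous[OF g'] by (intro continuous_at_imp_continuous_on) simp
    then show "continuous_on UNIV (S_c S c)"
      unfolding S_c_def case_prod_unfold by (auto intro!: continuous_intros)
    show "S_c S c (x', z') + S_c S c (x, z) + \<epsilon> * (x' - x) * (z' - z)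
        \<le> S_c S c (x', z) + S_c S c (x, z')" if "x \<le> x'" "z \<le> z'" for x x' z z'
      using twist_inequality[OF C2 \<epsilon>(2) that] by (simp add: S_c_def algebra_simps)
    fix R
    obtain K1 where K1: "\<And>x y. \<bar>x - y\<bar> \<le> R \<Longrightarrow> \<exists>p. \<bar>p\<bar> \<le> K1 \<and>
        (\<forall>h. \<bar>h\<bar> \<le> 1 \<longrightarrow> \<bar>S ((x, y) + h *\<^sub>R (1, 0)) - S (x, y) - p * h\<bar> \<le> K1 * h\<^sup>2)"
      using C2_periodic_expansion[OF C2 periodic, of R "(1, 0)"] by blast
    have "\<exists>p. \<bar>p\<bar> \<le> K1 + \<bar>c\<bar> \<and>
        (\<forall>h. \<bar>h\<bar> \<le> 1 \<longrightarrow> \<bar>S_c S c (x + h, y) - S_c S c (x, y) - p * h\<bar> \<le> (K1 + \<bar>c\<bar>) * h\<^sup>2)"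
      if xy: "\<bar>x - y\<bar> \<le> R" for x y
    proof -
      obtain p where p: "\<bar>p\<bar> \<le> K1"
        "\<And>h. \<bar>h\<bar> \<le> 1 \<Longrightarrow> \<bar>S (x + h, y) - S (x, y) - p * h\<bar> \<le> K1 * h\<^sup>2"
        using K1[OF xy] by auto
      have "\<bar>S_c S c (x + h, y) - S_c S c (x, y) - (p + c) * h\<bar> \<le> (K1 + \<bar>c\<bar>) * h\<^sup>2"
        if "\<bar>h\<bar> \<le> 1" for h
      proof -
        have eq: "S_c S c (x + h, y) - S_c S c (x, y) - (p + c) * h = S (x + h, y) - S (x, y) - p * h"
          by (simp add: S_c_def algebra_simps)
        have "K1 * h\<^sup>2 \<le> (K1 + \<bar>c\<bar>) * h\<^sup>2" by (intro mult_right_mono) auto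
        then show ?thesis unfolding eq using p(2)[OF that] by linarith
      qed
      then show ?thesis using p(1) by (intro exI[of _ "p + c"]) auto
    qed
    then show "\<exists>K. \<forall>x y. \<bar>x - y\<bar> \<le> R \<longrightarrow> (\<exists>p. \<bar>p\<bar> \<le> K \<and>
        (\<forall>h. \<bar>h\<bar> \<le> 1 \<longrightarrow> \<bar>S_c S c (x + h, y) - S_c S c (x, y) - p * h\<bar> \<le> K * h\<^sup>2))"
      by blast
    obtain K2 where K2: "\<And>x y. \<bar>x - y\<bar> \<le> R \<Longrightarrow> \<exists>p. \<bar>p\<bar> \<le> K2 \<and>
        (\<forall>h. \<bar>h\<bar> \<le> 1 \<longrightarrow> \<bar>S ((x, y) + h *\<^sub>R (0, 1)) - S (x, y) - p * h\<bar> \<le> K2 * h\<^sup>2)"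
      using C2_periodic_expansion[OF C2 periodic, of R "(0, 1)"] by blast
    have "\<exists>p. \<bar>p\<bar> \<le> K2 + \<bar>c\<bar> \<and>
        (\<forall>h. \<bar>h\<bar> \<le> 1 \<longrightarrow> \<bar>S_c S c (x, y + h) - S_c S c (x, y) - p * h\<bar> \<le> (K2 + \<bar>c\<bar>) * h\<^sup>2)"
      if xy: "\<bar>x - y\<bar> \<le> R" for x y
    proof -
      obtain p where p: "\<bar>p\<bar> \<le> K2"
        "\<And>h. \<bar>h\<bar> \<le> 1 \<Longrightarrow> \<bar>S (x, y + h) - S (x, y) - p * h\<bar> \<le> K2 * h\<^sup>2"
        using K2[OF xy] by auto
      have "\<bar>S_c S c (x, y + h) - S_c S c (x, y) - (p - c) * h\<bar> \<le> (K2 + \<bar>c\<bar>) * h\<^sup>2"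
        if "\<bar>h\<bar> \<le> 1" for h
      proof -
        have eq: "S_c S c (x, y + h) - S_c S c (x, y) - (p - c) * h = S (x, y + h) - S (x, y) - p * h"
          by (simp add: S_c_def algebra_simps)
        have "K2 * h\<^sup>2 \<le> (K2 + \<bar>c\<bar>) * h\<^sup>2" by (intro mult_right_mono) auto
        then show ?thesis unfolding eq using p(2)[OF that] by linarith
      qed
      then show ?thesis using p(1) by (intro exI[of _ "p - c"]) auto
    qed
    then show "\<exists>K. \<forall>x y. \<bar>x - y\<bar> \<le> R \<longrightarrow> (\<exists>p. \<bar>p\<bar> \<le> K \<and>
        (\<forall>h. \<bar>h\<bar> \<le> 1 \<longrightarrow> \<bar>S_c S c (x, y + h) - S_c S c (x, y) - p * h\<bar> \<le> K * h\<^sup>2))"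
      by blast
  qed (rule \<epsilon>(1))
  then show ?thesis ..
qed

section \<open>Regularity for twist maps\<close>

theorem theorem1p4:
  fixes f :: "annulus \<Rightarrow> annulus"
    and F :: "real \<times> real \<Rightarrow> real \<times> real"
    and S :: "real \<times> real \<Rightarrow> real"
    and c :: real
    and u :: "real \<Rightarrow> real"
  assumes "twist_map f"
    and "is_lift F f"
    and "generating_function S F"
    and "bounded (range u)"
    and "\<forall>x. u (x + 1) = u x"
  shows "C11 (T_plus S c (T_minus S c (T_minus S c u)))"
proof -
  obtain \<epsilon> where "twist_cost (S_c S c) \<epsilon>" using twist_cost_S_c[OF assms(3)] by blast
  then interpret twist_cost "S_c S c" \<epsilon> .
  have "T_minus S c = backward" "T_plus S c = forward"
    by (simp_all add: fun_eq_iff T_minus_def T_plus_def backward_def forward_def)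
  then show ?thesis using C11_forward_backward_backward[OF assms(4)] by simp
qed

end
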